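(* Let $n>1$ and let $S,K\subset\mathbb{R}^n$ be two (closed, bounded) symmetric convex bodies. Suppose that every set $\Lambda\subset\mathbb{R}^n$ satisfying $(\Lambda-\Lambda)\cap K=\{0\}$ is an interpolation set for $PW_S$. Then $$|S|\cdot|K|>(2\pi)^n.$$
   Context: $|S|$ denotes Lebesgue measure and $\Lambda-\Lambda=\{\lambda-\lambda':\lambda,\lambda'\in\Lambda\}$. Symmetric means symmetric about the origin. For a bounded set $S\subset\mathbb{R}^n$ of positive measure, the Paley--Wiener space $PW_S$ consists of all Fourier transforms $\hat F(t)=(2\pi)^{-n/2}\int_{\mathbb{R}^n}e^{-it\cdot x}F(x)\,dx$ of functions $F\in L^2(\mathbb{R}^n)$ vanishing a.e. outside $S$ (its elements are continuous functions). A countable set $\Lambda$ is an interpolation set for $PW_S$ if for every $c\in\ell^2(\Lambda)$ there is $f\in PW_S$ with $f(\lambda)=c(\lambda)$ for all $\lambda\in\Lambda$. *)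

theory Defs
  imports "HOL-Analysis.Analysis"
begin

definition symmetric_convex_body :: "(real ^ 'n) set \<Rightarrow> bool" where
  "symmetric_convex_body S \<longleftrightarrow>
     compact S \<and> convex S \<and> interior S \<noteq> {} \<and> (\<forall>x\<in>S. - x \<in> S)"

definition square_integrable :: "(real ^ 'n \<Rightarrow> complex) \<Rightarrow> bool" where
  "square_integrable F \<longleftrightarrow>
     F \<in> borel_measurable lebesgue \<and> integrable lebesgue (\<lambda>x. (cmod (F x))\<^sup>2)"

definition fourier_transform :: "(real ^ 'n \<Rightarrow> complex) \<Rightarrow> real ^ 'n \<Rightarrow> complex" where
  "fourier_transform F t =
     complex_of_real ((2 * pi) powr (- (real CARD('n) / 2))) *
     (LINT x|lebesgue. exp (- (\<i> * complex_of_real (t \<bullet> x))) * F x)"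

(* Meant for bounded S: then F is also in L^1, so the Fourier integral converges absolutely
   at every t and yields the continuous representative, which can be evaluated pointwise. *)
definition paley_wiener :: "(real ^ 'n) set \<Rightarrow> (real ^ 'n \<Rightarrow> complex) set" where
  "paley_wiener S =
     {fourier_transform F |F. square_integrable F \<and> (AE x in lebesgue. x \<notin> S \<longrightarrow> F x = 0)}"

(* Data c in l^2(L) are total functions, of which only the values on L matter. *)
definition interpolation_set :: "(real ^ 'n) set \<Rightarrow> (real ^ 'n) set \<Rightarrow> bool" where
  "interpolation_set S L \<longleftrightarrow> countable L \<and>
     (\<forall>c :: real ^ 'n \<Rightarrow> complex. (\<lambda>l. (cmod (c l))\<^sup>2) summable_on L \<longrightarrow>
        (\<exists>f\<in>paley_wiener S. \<forall>l\<in>L. f l = c l))"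

definition difference_set :: "(real ^ 'n) set \<Rightarrow> (real ^ 'n) set" where
  "difference_set L = {x - y |x y. x \<in> L \<and> y \<in> L}"

end

theory Submission
  imports Defs "HOL-Computational_Algebra.Primes"
begin

text \<open>
  The interpolation property is applied to one well-chosen lattice \<open>\<Lambda>\<close> and to the data that are
  \<open>1\<close> at the origin and \<open>0\<close> elsewhere on \<open>\<Lambda>\<close>.

  Suppose that \<open>\<Lambda>\<close> is a lattice with dual lattice \<open>\<Gamma>\<close> (normalised so that inner products of
  elements of \<open>\<Lambda>\<close> and \<open>\<Gamma>\<close> lie in \<open>2\<pi>\<int>\<close>), and that \<open>F\<close> is supported on \<open>S\<close> and its transform
  takes these values on \<open>\<Lambda>\<close>. The values of the transform on \<open>\<Lambda>\<close> are the Fourier coefficients of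
  the \<open>\<Gamma>\<close>-periodization of \<open>F\<close>, so this periodization is a nonzero constant; hence its support
  \<open>S + \<Gamma>\<close> is all of space, and \<open>S\<close> has at least the volume of a fundamental domain of \<open>\<Gamma>\<close>, which
  is \<open>(2\<pi>)\<^sup>n / covol \<Lambda>\<close>. The lemma \<open>interpolation_lattice_imp_cover\<close> makes this precise by
  testing \<open>F\<close> against trigonometric polynomials that concentrate at a point assumed to be uncovered,
  and \<open>measure_ge_if_basis_matrix_image_cover\<close> draws the conclusion about volumes.

  It remains to find a lattice that meets \<open>K\<close> only in the origin and has covolume strictly smaller
  than \<open>|K|\<close>: this gives \<open>|S| |K| > |S| covol \<Lambda> \<ge> (2\<pi>)\<^sup>n\<close>. In dimension at least two, a weak form
  of the Minkowski--Hlawka theorem for symmetric convex bodies,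
  \<open>lattice_avoiding_convex_body\<close>, provides every covolume larger than \<open>|K| / 2\<close>. Its proof is a
  pigeonhole argument over the \<open>p^(n-1)\<close> lattices
  \<open>{x \<in> \<epsilon>\<int>\<^sup>n. x\<^sub>j \<equiv> x\<^sub>k a\<^sub>j (mod \<epsilon>p) for all j}\<close> for a large prime \<open>p\<close>. A point of \<open>K\<close> whose
  coordinate \<open>x\<^sub>k\<close> is not divisible by \<open>\<epsilon>p\<close> lies in only one of them, all other nonzero points of
  these lattices are too long to be in \<open>K\<close>, and \<open>K\<close> contains about \<open>|K| / \<epsilon>\<^sup>n\<close> points of
  \<open>\<epsilon>\<int>\<^sup>n\<close>, which come in pairs \<open>\<plusminus>x\<close>.
\<close>

section \<open>Cubic lattices and volume\<close>

definition int_point :: "int ^ 'n \<Rightarrow> real ^ 'n" where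
  "int_point z = (\<chi> i. real_of_int (z $ i))"

definition half_open_cube :: "real \<Rightarrow> (real ^ 'n) set" where
  "half_open_cube l = {x. \<forall>i. 0 \<le> x $ i \<and> x $ i < l}"

lemma int_point_nth [simp]: "int_point z $ i = real_of_int (z $ i)"
  by (simp add: int_point_def)

lemma int_point_diff: "int_point (z - w) = int_point z - int_point w"
  by (simp add: vec_eq_iff)

lemma int_point_uminus: "int_point (- z) = - int_point z"
  by (simp add: vec_eq_iff)

lemma box_vec_eq_image: "{z :: 'a ^ 'n. \<forall>i. z $ i \<in> A i} = vec_lambda ` (PiE UNIV A)"
proof -
  have "z \<in> vec_lambda ` (PiE UNIV A)" if "\<forall>i. z $ i \<in> A i" for z :: "'a ^ 'n"
    using that by (intro image_eqI[of _ _ "vec_nth z"]) auto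
  then show ?thesis by (auto simp: PiE_iff)
qed

lemma finite_box_vec:
  assumes "\<And>i. finite (A i)"
  shows "finite {z :: 'a ^ 'n. \<forall>i. z $ i \<in> A i}"
  unfolding box_vec_eq_image by (intro finite_imageI finite_PiE) (auto simp: assms)

lemma card_box_vec: "card {z :: 'a ^ 'n. \<forall>i. z $ i \<in> A i} = (\<Prod>i\<in>UNIV. card (A i))"
  unfolding box_vec_eq_image
  by (subst card_image) (auto simp: card_PiE inj_on_def vec_lambda_inject)

lemma
  shows half_open_cube_lmeasurable: "(half_open_cube l :: (real ^ 'n) set) \<in> lmeasurable"
    and measure_half_open_cube:
      "l > 0 \<Longrightarrow> measure lebesgue (half_open_cube l :: (real ^ 'n) set) = l ^ CARD('n)"
proof -
  let ?a = "0 :: real ^ 'n" and ?b = "\<chi> i. l :: real ^ 'n"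
  have sub: "box ?a ?b \<subseteq> half_open_cube l" "half_open_cube l \<subseteq> cbox ?a ?b"
    by (auto simp: half_open_cube_def mem_box_cart less_imp_le)
  have neg: "negligible (cbox ?a ?b - box ?a ?b)"
    by (simp add: negligible_frontier_interval)
  have "negligible (cbox ?a ?b - half_open_cube l)"
    by (rule negligible_subset[OF neg]) (use sub in auto)
  then have neg': "negligible (half_open_cube l - cbox ?a ?b \<union> (cbox ?a ?b - half_open_cube l))"
    using sub(2) by (simp add: Diff_eq_empty_iff[THEN iffD2])
  show meas: "(half_open_cube l :: (real ^ 'n) set) \<in> lmeasurable"
    using lmeasurable_negligible_symdiff[OF lmeasurable_cbox[of ?a ?b]] neg'
    by (simp add: Un_commute)
  have "measure lebesgue (half_open_cube l :: (real ^ 'n) set) = measure lebesgue (cbox ?a ?b)"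
    using measure_negligible_symdiff[OF meas] neg' by (metis Un_commute)
  then show "measure lebesgue (half_open_cube l :: (real ^ 'n) set) = l ^ CARD('n)" if "l > 0"
    using that by (simp add: content_cbox_if_cart interval_ne_empty_cart not_le)
qed

text \<open>Half-open cubes are used because their translates by
  \<open>l \<int>\<^sup>n\<close> partition the space exactly: each point lies in the one cube that rounding down its
  coordinates determines.\<close>

lemma half_open_cube_tiles:
  assumes "l > 0"
  shows "x - l *\<^sub>R int_point z \<in> half_open_cube l \<longleftrightarrow> z = (\<chi> i. \<lfloor>x $ i / l\<rfloor>)"
proof -
  have "0 \<le> x $ i - l * real_of_int m \<and> x $ i - l * real_of_int m < l \<longleftrightarrow> \<lfloor>x $ i / l\<rfloor> = m" for i m
    using assms by (auto simp: floor_eq_iff field_simps)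
  then show ?thesis by (auto simp: half_open_cube_def vec_eq_iff)
qed

lemma disjoint_cubes:
  assumes "l > 0"
  shows "pairwise (\<lambda>z w. disjnt ((+) (l *\<^sub>R int_point z) ` half_open_cube l)
    ((+) (l *\<^sub>R int_point w) ` (half_open_cube l :: (real ^ 'n) set))) Z"
proof -
  have *: "x \<in> (+) (l *\<^sub>R int_point z) ` half_open_cube l \<longleftrightarrow> x - l *\<^sub>R int_point z \<in> half_open_cube l" 
    for x :: "real ^ 'n" and z
    by (auto simp: image_iff algebra_simps) (metis add_diff_cancel_left' add_diff_cancel_right' diff_add_cancel)
  show ?thesis
    unfolding pairwise_def disjnt_iff * half_open_cube_tiles[OF assms] by metis
qed

lemma card_cubes_le_measure:
  fixes X :: "(int ^ 'n) set"
  assumes "l > 0" "finite X" "T \<in> lmeasurable"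
    and sub: "\<And>z. z \<in> X \<Longrightarrow> (+) (l *\<^sub>R int_point z) ` half_open_cube l \<subseteq> T"
  shows "real (card X) * l ^ CARD('n) \<le> measure lebesgue T"
proof -
  let ?Q = "\<lambda>z. (+) (l *\<^sub>R int_point z) ` (half_open_cube l :: (real ^ 'n) set)"
  have m: "?Q z \<in> lmeasurable" for z
    by (intro measurable_translation half_open_cube_lmeasurable)
  have "measure lebesgue (\<Union>z\<in>X. ?Q z) = (\<Sum>z\<in>X. measure lebesgue (?Q z))"
    by (intro measure_UNION' m disjoint_cubes assms)
  also have "\<dots> = real (card X) * l ^ CARD('n)"
    using \<open>l > 0\<close> by (simp add: measure_translation measure_half_open_cube)
  finally show ?thesis
    using measure_mono_fmeasurable[of "\<Union>z\<in>X. ?Q z" T lebesgue] sub m assms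
    by (metis (no_types, lifting) UN_least fmeasurableD fmeasurable.finite_UN)
qed

text \<open>If the translates of \<open>T\<close> by \<open>l \<int>\<^sup>n\<close> cover the
  space, cut the cube \<open>[0,l)\<^sup>n\<close> into pieces, each inside one translate of \<open>T\<close>, and move each piece
  back into \<open>T\<close>. The moved pieces lie in different cubes of the tiling, so their total volume
  is at most that of \<open>T\<close>.\<close>

lemma measure_ge_if_translates_cover:
  fixes T :: "(real ^ 'n) set"
  assumes "l > 0" "compact T"
    and cover: "\<And>y. \<exists>z. y + l *\<^sub>R int_point z \<in> T"
  shows "l ^ CARD('n) \<le> measure lebesgue T"
proof -
  let ?C = "half_open_cube l :: (real ^ 'n) set"
  have T: "T \<in> lmeasurable" using \<open>compact T\<close> by (rule lmeasurable_compact)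
  obtain R where R: "\<And>x. x \<in> T \<Longrightarrow> norm x \<le> R"
    using compact_imp_bounded[OF \<open>compact T\<close>] by (auto simp: bounded_iff)
  \<comment> \<open>Only finitely many translates of the bounded set \<open>T\<close> reach the cube.\<close>
  define J where "J = {z :: int ^ 'n. \<forall>i. z $ i \<in> {- \<lceil>(R + l) / l\<rceil>..\<lceil>(R + l) / l\<rceil>}}"
  have "finite J" unfolding J_def by (rule finite_box_vec) simp
  have inJ: "z \<in> J" if "y \<in> ?C" "y + l *\<^sub>R int_point z \<in> T" for y z
  proof -
    have "\<bar>z $ i\<bar> \<le> \<lceil>(R + l) / l\<rceil>" for i
    proof -
      have "\<bar>y $ i + l * z $ i\<bar> \<le> R"
        using component_le_norm_cart[of "y + l *\<^sub>R int_point z" i] R[OF that(2)] by simp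
      moreover have "0 \<le> y $ i" "y $ i < l" using that(1) by (auto simp: half_open_cube_def)
      ultimately have "\<bar>l * z $ i\<bar> \<le> R + l" by linarith
      then have "\<bar>real_of_int (z $ i)\<bar> \<le> (R + l) / l"
        using \<open>l > 0\<close> by (simp add: abs_mult field_simps)
      then show ?thesis by linarith
    qed
    then show ?thesis unfolding J_def by (auto simp: abs_le_iff minus_le_iff)
  qed
  let ?Q = "\<lambda>z. (+) (l *\<^sub>R int_point z) ` ?C"
  have mQ: "?Q z \<in> lmeasurable" for z
    by (intro measurable_translation half_open_cube_lmeasurable)
  have mT: "(+) (- (l *\<^sub>R int_point z)) ` T \<in> lmeasurable" for z :: "int ^ 'n"
    by (intro measurable_translation T)
  have shift: "(+) (l *\<^sub>R int_point z) ` (?C \<inter> (+) (- (l *\<^sub>R int_point z)) ` T) = ?Q z \<inter> T" for z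
    by (subst image_Int) (auto simp: image_image)
  have "?C \<subseteq> (\<Union>z\<in>J. ?C \<inter> (+) (- (l *\<^sub>R int_point z)) ` T)"
  proof
    fix y assume y: "y \<in> ?C"
    obtain z where z: "y + l *\<^sub>R int_point z \<in> T" using cover by blast
    have "y = - (l *\<^sub>R int_point z) + (y + l *\<^sub>R int_point z)" by simp
    then have "y \<in> (+) (- (l *\<^sub>R int_point z)) ` T" using z by blast
    then show "y \<in> (\<Union>z\<in>J. ?C \<inter> (+) (- (l *\<^sub>R int_point z)) ` T)"
      using inJ[OF y z] y by blast
  qed
  then have "?C = (\<Union>z\<in>J. ?C \<inter> (+) (- (l *\<^sub>R int_point z)) ` T)" by blast
  then have "measure lebesgue ?C
      \<le> (\<Sum>z\<in>J. measure lebesgue (?C \<inter> (+) (- (l *\<^sub>R int_point z)) ` T))"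
    using measure_UNION_le[OF \<open>finite J\<close>, of "\<lambda>z. ?C \<inter> (+) (- (l *\<^sub>R int_point z)) ` T" lebesgue]
      half_open_cube_lmeasurable mT by (metis (no_types, lifting) fmeasurableD sets.Int)
  also have "\<dots> = (\<Sum>z\<in>J. measure lebesgue (?Q z \<inter> T))"
    by (simp only: shift[symmetric] measure_translation)
  also have "\<dots> = measure lebesgue (\<Union>z\<in>J. ?Q z \<inter> T)"
    by (rule measure_UNION'[symmetric])
      (auto simp: \<open>finite J\<close> fmeasurable.Int mQ T
        intro: pairwise_mono[OF disjoint_cubes[OF \<open>l > 0\<close>, of J]] disjnt_subset1 disjnt_subset2)
  also have "\<dots> \<le> measure lebesgue T"
    by (rule measure_mono_fmeasurable) (use \<open>finite J\<close> mQ T in \<open>auto intro!: sets.finite_UN sets.Int\<close>)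
  finally show ?thesis using \<open>l > 0\<close> by (simp add: measure_half_open_cube)
qed

section \<open>Interpolation of a unit impulse on a lattice forces a covering\<close>

lemma cos_power_eq_sum_exp:
  "complex_of_real (cos (t / 2) ^ (2 * N))
     = (\<Sum>k\<le>2 * N. of_real (real (2 * N choose k) / 4 ^ N) * exp (\<i> * of_real ((real k - real N) * t)))"
proof -
  define w where "w = exp (\<i> * of_real (t / 2))"
  have w: "w \<noteq> 0" "inverse w = exp (- (\<i> * of_real (t / 2)))"
    by (auto simp: w_def exp_minus)
  have "complex_of_real (cos (t / 2)) = (w + inverse w) / 2"
    by (simp only: cos_of_real[symmetric] cos_exp_eq w(2)) (simp add: w_def)
  then have "complex_of_real (cos (t / 2) ^ (2 * N)) = ((w + inverse w) / 2) ^ (2 * N)"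
    by (simp only: of_real_power)
  also have "\<dots> = (w + inverse w) ^ (2 * N) / 4 ^ N"
    by (simp add: power_divide power_mult)
  also have "\<dots> = (\<Sum>k\<le>2 * N. of_nat (2 * N choose k) * w ^ k * inverse w ^ (2 * N - k)) / 4 ^ N"
    by (simp add: binomial_ring)
  also have "\<dots> = (\<Sum>k\<le>2 * N. of_real (real (2 * N choose k) / 4 ^ N) * exp (\<i> * of_real ((real k - real N) * t)))"
    unfolding sum_divide_distrib
  proof (rule sum.cong[OF refl])
    fix k assume k: "k \<in> {..2 * N}"
    have "w ^ k * inverse w ^ (2 * N - k) = exp (\<i> * of_real ((real k - real N) * t))"
      unfolding w(2) unfolding w_def exp_of_nat_mult[symmetric] exp_add[symmetric]
      using k by (simp add: of_nat_diff algebra_simps)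
    then show "of_nat (2 * N choose k) * w ^ k * inverse w ^ (2 * N - k) / 4 ^ N
        = of_real (real (2 * N choose k) / 4 ^ N) * exp (\<i> * of_real ((real k - real N) * t))"
      by (simp add: mult.assoc)
  qed
  finally show ?thesis .
qed

text \<open>The peaking kernel \<open>\<Prod>\<^sub>j cos\<^sup>2\<^sup>N(t\<^sub>j/2)\<close> as a
  trigonometric polynomial. Its constant term is \<open>((2N choose N) / 4^N)^n\<close>, which decays only
  polynomially in \<open>N\<close>, whereas away from \<open>2\<pi>\<int>\<^sup>n\<close> the kernel decays geometrically.\<close>

lemma prod_cos_power_eq_sum_exp:
  fixes t :: "real ^ 'n"
  shows "complex_of_real (\<Prod>j\<in>UNIV. cos (t $ j / 2) ^ (2 * N))
     = (\<Sum>k\<in>PiE UNIV (\<lambda>_. {..2 * N}).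
          of_real (\<Prod>j\<in>UNIV. real (2 * N choose k j) / 4 ^ N)
          * exp (\<i> * of_real (int_point (\<chi> j. int (k j) - int N) \<bullet> t)))"
proof -
  have "complex_of_real (\<Prod>j\<in>UNIV. cos (t $ j / 2) ^ (2 * N)) = (\<Prod>j\<in>UNIV. \<Sum>k\<le>2 * N.
      of_real (real (2 * N choose k) / 4 ^ N) * exp (\<i> * of_real ((real k - real N) * t $ j)))"
    by (simp only: of_real_prod cos_power_eq_sum_exp)
  also have "\<dots> = (\<Sum>k\<in>PiE UNIV (\<lambda>_. {..2 * N}). \<Prod>j\<in>UNIV.
      of_real (real (2 * N choose k j) / 4 ^ N) * exp (\<i> * of_real ((real (k j) - real N) * t $ j)))"
    by (rule prod_sum_PiE) auto
  also have "\<dots> = (\<Sum>k\<in>PiE UNIV (\<lambda>_. {..2 * N}).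
          of_real (\<Prod>j\<in>UNIV. real (2 * N choose k j) / 4 ^ N)
          * exp (\<i> * of_real (int_point (\<chi> j. int (k j) - int N) \<bullet> t)))"
    by (simp only: prod.distrib of_real_prod exp_sum[OF finite, symmetric] inner_vec_def of_real_sum
        sum_distrib_left) (simp add: mult.assoc)
  finally show ?thesis .
qed

text \<open>On a set of finite measure, square integrability implies
  integrability; here through the pointwise bound \<open>r \<le> 1 + r\<^sup>2\<close>. It makes all Fourier integrals
  of \<open>F\<close> converge absolutely.\<close>

lemma square_integrable_imp_integrable:
  assumes "square_integrable F" "S \<in> lmeasurable"
    and "AE x in lebesgue. x \<notin> S \<longrightarrow> F x = 0"
  shows "integrable lebesgue F"
proof (rule Bochner_Integration.integrable_bound)
  show "integrable lebesgue (\<lambda>x. indicator S x + (cmod (F x))\<^sup>2)"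
    using assms by (auto simp: square_integrable_def fmeasurable_def intro!: Bochner_Integration.integrable_add)
  show "F \<in> borel_measurable lebesgue" using assms by (simp add: square_integrable_def)
  have *: "r \<le> 1 + r\<^sup>2" for r :: real
    using zero_le_power2[of "r - 1/2"] by (simp add: power2_eq_square algebra_simps)
  show "AE x in lebesgue. norm (F x) \<le> norm (indicator S x + (cmod (F x))\<^sup>2)"
    using assms(3) by eventually_elim (use * in \<open>auto simp: indicator_def\<close>)
qed

lemma central_coeff_lower_bound:
  assumes "N > 0" shows "real (2 * N choose N) / 4 ^ N \<ge> 1 / (2 * real N)"
  using central_binomial_lower_bound[OF assms] assms by (simp add: field_simps)

lemma poly_mult_geometric_tendsto_0:
  assumes "0 \<le> q" "q < (1::real)"
  shows "(\<lambda>N. (2 * real N) ^ n * q ^ N) \<longlonglongrightarrow> 0"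
proof (cases "n = 0")
  case True
  then show ?thesis using assms by (simp add: LIMSEQ_realpow_zero)
next
  case False
  define r where "r = root n q"
  have r: "0 \<le> r" "r < 1" "r ^ n = q"
    using False assms by (auto simp: r_def)
  have "(\<lambda>N. real N * r ^ N) \<longlonglongrightarrow> 0"
    using powser_times_n_limit_0[of r] r by simp
  then have "(\<lambda>N. (2 * (real N * r ^ N)) ^ n) \<longlonglongrightarrow> (2 * 0) ^ n"
    by (intro tendsto_intros)
  then have "(\<lambda>N. (2 * (real N * r ^ N)) ^ n) \<longlonglongrightarrow> 0"
    using False by (simp only: mult_zero_right zero_power neq0_conv)
  moreover have "(\<lambda>N. (2 * (real N * r ^ N)) ^ n) = (\<lambda>N. (2 * real N) ^ n * q ^ N)"
    by (simp add: power_mult_distrib r(3)[symmetric] power_mult[symmetric] ac_simps)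
  ultimately show ?thesis by (simp only:)
qed

text \<open>For invertible \<open>M\<close>, the lattice \<open>L = {z M. z \<in> \<int>\<^sup>n}\<close> has the dual lattice
  \<open>2\<pi> M\<^sup>-\<^sup>1 \<int>\<^sup>n\<close>, and the conclusion is the image under \<open>M\<close> of the claim that the translates of \<open>S\<close>
  by the dual lattice cover the space. If \<open>y\<close> were uncovered, then the peaking kernel centred at
  \<open>y\<close> would be at most \<open>q^N\<close> with \<open>q < 1\<close> on the compact image of \<open>S\<close>. Integrating it against \<open>F\<close> therefore gives something
  geometrically small. But this integral is a combination of values of the transform of \<open>F\<close> on \<open>L\<close>,
  of which only the value at the origin is nonzero, so that it equals the constant
  coefficient of the kernel up to a fixed factor, and this is only polynomially small.\<close>

lemma interpolation_lattice_imp_cover: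
  fixes S :: "(real ^ 'n) set" and M :: "real ^ 'n ^ 'n"
  assumes "compact S"
    and inj: "\<And>z. z \<noteq> 0 \<Longrightarrow> int_point z v* M \<noteq> 0"
    and interp: "interpolation_set S (range (\<lambda>z. int_point z v* M))"
  shows "\<exists>z. y + (2 * pi) *\<^sub>R int_point z \<in> (*v) M ` S"
proof (rule ccontr)
  assume uncovered: "\<not> ?thesis"
  define c :: "real ^ 'n \<Rightarrow> complex" where "c = (\<lambda>l. if l = 0 then 1 else 0)"
  have "(\<lambda>l. (cmod (c l))\<^sup>2) summable_on range (\<lambda>z. int_point z v* M)"
    by (rule finite_nonzero_values_imp_summable_on)
      (auto simp: c_def intro: finite_subset[of _ "{0}"])
  then obtain F where F2: "square_integrable F"
    and supp: "AE x in lebesgue. x \<notin> S \<longrightarrow> F x = 0"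
    and val: "\<And>z. fourier_transform F (int_point z v* M) = c (int_point z v* M)"
    using interp unfolding interpolation_set_def paley_wiener_def by fastforce
  have S: "S \<in> lmeasurable" using \<open>compact S\<close> by (rule lmeasurable_compact)
  have F: "integrable lebesgue F"
    by (rule square_integrable_imp_integrable[OF F2 S supp])
  define J where "J z = (LINT x|lebesgue. exp (- (\<i> * of_real (int_point z \<bullet> (M *v x)))) * F x)" for z
  define C where "C = (2 * pi) powr (real CARD('n) / 2)"
  have "C > 0" by (simp add: C_def)
  have J: "J z = (if z = 0 then of_real C else 0)" for z
  proof -
    have "of_real (inverse C) * J z = fourier_transform F (int_point z v* M)"
      by (simp add: fourier_transform_def J_def C_def dot_lmul_matrix powr_minus)
    also have "\<dots> = (if z = 0 then 1 else 0)"
      using inj[of z] unfolding val c_def by (auto simp: int_point_def vec_eq_iff vector_matrix_mult_def)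
    finally show ?thesis using \<open>C > 0\<close> by (auto simp: field_simps split: if_splits)
  qed
  define h where "h x = (\<Prod>j\<in>UNIV. (cos (((M *v x) - y) $ j / 2))\<^sup>2)" for x
  have h0: "0 \<le> h x" and h1: "h x \<le> 1" for x
    by (auto simp: h_def intro!: prod_nonneg prod_le_1 simp: abs_square_le_1)
  \<comment> \<open>The kernel equals 1 only when \<open>M x\<close> and \<open>y\<close> differ by an element of \<open>2\<pi>\<int>\<^sup>n\<close>.\<close>
  have h_less: "h x < 1" if "x \<in> S" for x
  proof (rule ccontr)
    assume "\<not> h x < 1"
    then have "h x = 1" using h1[of x] by simp
    have "(cos (((M *v x) - y) $ j / 2))\<^sup>2 = 1" for j
    proof -
      have "h x = (cos (((M *v x) - y) $ j / 2))\<^sup>2 * (\<Prod>j\<in>UNIV - {j}. (cos (((M *v x) - y) $ j / 2))\<^sup>2)"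
        unfolding h_def by (rule prod.remove) auto
      also have "\<dots> \<le> (cos (((M *v x) - y) $ j / 2))\<^sup>2"
        by (intro mult_right_le_one_le prod_nonneg prod_le_1) (auto simp: abs_square_le_1)
      finally show ?thesis
        using \<open>h x = 1\<close> by (metis abs_cos_le_one abs_square_le_1 order_antisym)
    qed
    then have "sin (((M *v x) - y) $ j / 2) = 0" for j
      by (metis add_cancel_right_left power2_eq_square mult_eq_0_iff sin_cos_squared_add)
    then have "\<exists>m. ((M *v x) - y) $ j / 2 = real_of_int m * pi" for j
      using sin_zero_iff_int2 by auto
    then obtain m where m: "\<And>j. ((M *v x) - y) $ j / 2 = real_of_int (m j) * pi"
      by metis
    have "y + (2 * pi) *\<^sub>R int_point (\<chi> j. m j) = M *v x"
    proof (simp add: vec_eq_iff, intro allI)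
      fix j show "y $ j + 2 * pi * real_of_int (m j) = (M *v x) $ j"
        using m[of j] by (simp add: field_simps)
    qed
    then show False using uncovered that by force
  qed
  have contM: "continuous_on A (\<lambda>x. M *v x)" for A
    by (rule linear_continuous_on) (rule matrix_vector_mul_bounded_linear)
  have cont: "continuous_on A h" for A
    unfolding h_def by (intro continuous_intros contM) auto
  obtain q where q: "0 \<le> q" "q < 1" "\<And>x. x \<in> S \<Longrightarrow> h x \<le> q"
  proof (cases "S = {}")
    case True
    then show ?thesis using that[of 0] by simp
  next
    case False
    then obtain x0 where "x0 \<in> S" "\<forall>x\<in>S. h x \<le> h x0"
      using continuous_attains_sup[OF \<open>compact S\<close> _ cont] by blast
    then show ?thesis using that[of "h x0"] h_less h0 by auto
  qed
  have int_exp: "integrable lebesgue (\<lambda>x. exp (\<i> * of_real (a \<bullet> (M *v x) + b)) * F x)" for a b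
  proof (rule Bochner_Integration.integrable_bound[OF F])
    have "continuous_on UNIV (\<lambda>x. exp (\<i> * complex_of_real (a \<bullet> (M *v x) + b)))"
      by (intro continuous_intros contM)
    then have "(\<lambda>x. exp (\<i> * complex_of_real (a \<bullet> (M *v x) + b))) \<in> borel_measurable lebesgue"
      by (intro measurable_completion) (simp add: borel_measurable_continuous_onI)
    then show "(\<lambda>x. exp (\<i> * of_real (a \<bullet> (M *v x) + b)) * F x) \<in> borel_measurable lebesgue"
      using borel_measurable_integrable[OF F] by simp
  qed (simp add: norm_mult)
  \<comment> \<open>Compare the two evaluations of the integral of \<open>h^N F\<close>.\<close>
  have main: "C \<le> (2 * real N) ^ CARD('n) * q ^ N * (LINT x|lebesgue. cmod (F x))" if "N > 0" for N
  proof -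
    let ?k = "\<lambda>k :: 'n \<Rightarrow> nat. (\<chi> j. int (k j) - int N) :: int ^ 'n"
    let ?b = "\<lambda>k. \<Prod>j\<in>(UNIV :: 'n set). real (2 * N choose k j) / 4 ^ N"
    let ?e = "\<lambda>k x. exp (\<i> * complex_of_real (int_point (?k k) \<bullet> (M *v x) + - (int_point (?k k) \<bullet> y)))"
    have hN: "of_real (h x ^ N) = (\<Sum>k\<in>PiE UNIV (\<lambda>_. {..2 * N}). of_real (?b k) * ?e k x)" for x
      using prod_cos_power_eq_sum_exp[of "M *v x - y" N]
      by (simp add: h_def prod_power_distrib power_mult inner_diff_right)
    have "(LINT x|lebesgue. of_real (h x ^ N) * F x)
        = (LINT x|lebesgue. (\<Sum>k\<in>PiE UNIV (\<lambda>_. {..2 * N}). of_real (?b k) * (?e k x * F x)))"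
      by (simp only: hN sum_distrib_right mult.assoc)
    also have "\<dots> = (\<Sum>k\<in>PiE UNIV (\<lambda>_. {..2 * N}). of_real (?b k) * (LINT x|lebesgue. ?e k x * F x))"
      by (subst Bochner_Integration.integral_sum)
        (intro integrable_mult_right int_exp, simp only: integral_mult_right_zero)
    also have "\<dots> = (\<Sum>k\<in>PiE UNIV (\<lambda>_. {..2 * N}). if k = (\<lambda>_. N) then of_real (?b k * C) else 0)"
    proof (rule sum.cong[OF refl])
      fix k :: "'n \<Rightarrow> nat"
      have "?e k x = exp (- (\<i> * of_real (int_point (?k k) \<bullet> y))) *
          exp (- (\<i> * of_real (int_point (- ?k k) \<bullet> (M *v x))))" for x
        unfolding exp_add[symmetric] int_point_uminus
        by (rule arg_cong[where f = exp]) (simp add: distrib_left right_diff_distrib)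
      then have "(LINT x|lebesgue. ?e k x * F x)
          = (LINT x|lebesgue. exp (- (\<i> * of_real (int_point (?k k) \<bullet> y))) *
               (exp (- (\<i> * of_real (int_point (- ?k k) \<bullet> (M *v x)))) * F x))"
        by (simp only: mult.assoc)
      also have "\<dots> = exp (- (\<i> * of_real (int_point (?k k) \<bullet> y))) * J (- ?k k)"
        by (simp add: J_def)
      also have "\<dots> = (if k = (\<lambda>_. N) then of_real C else 0)"
        by (auto simp: J vec_eq_iff fun_eq_iff int_point_def inner_vec_def)
      finally show "of_real (?b k) * (LINT x|lebesgue. ?e k x * F x)
          = (if k = (\<lambda>_. N) then of_real (?b k * C) else 0)"
        by simp
    qed
    also have "\<dots> = of_real ((real (2 * N choose N) / 4 ^ N) ^ CARD('n) * C)"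
      by (subst sum.delta) (auto intro: finite_PiE)
    finally have eq: "(LINT x|lebesgue. of_real (h x ^ N) * F x)
        = of_real ((real (2 * N choose N) / 4 ^ N) ^ CARD('n) * C)" .
    have "(1 / (2 * real N)) ^ CARD('n) * C \<le> (real (2 * N choose N) / 4 ^ N) ^ CARD('n) * C"
      using central_coeff_lower_bound[OF that] \<open>C > 0\<close> by (intro mult_right_mono power_mono) auto
    also have "\<dots> = cmod (LINT x|lebesgue. of_real (h x ^ N) * F x)"
      unfolding eq norm_of_real using \<open>C > 0\<close> by simp
    also have "\<dots> \<le> (LINT x|lebesgue. cmod (of_real (h x ^ N) * F x))"
      by (rule Bochner_Integration.integral_norm_bound)
    also have "\<dots> \<le> (LINT x|lebesgue. q ^ N * cmod (F x))"
    proof (rule integral_mono_AE)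
      have "integrable lebesgue (\<lambda>x. (\<Sum>k\<in>PiE UNIV (\<lambda>_. {..2 * N}). of_real (?b k) * (?e k x * F x)))"
        by (intro Bochner_Integration.integrable_sum integrable_mult_right int_exp)
      then have "integrable lebesgue (\<lambda>x. of_real (h x ^ N) * F x)"
        by (simp only: hN sum_distrib_right mult.assoc)
      then show "integrable lebesgue (\<lambda>x. cmod (of_real (h x ^ N) * F x))"
        by (rule Bochner_Integration.integrable_norm)
      show "integrable lebesgue (\<lambda>x. q ^ N * cmod (F x))" using F by simp
    next
      show "AE x in lebesgue. cmod (of_real (h x ^ N) * F x) \<le> q ^ N * cmod (F x)"
        using supp
      proof eventually_elim
        case (elim x)
        then show ?case
          using q(3)[of x] h0[of x] by (cases "x \<in> S") (auto simp: norm_mult norm_power intro!: mult_right_mono power_mono)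
      qed
    qed
    also have "\<dots> = q ^ N * (LINT x|lebesgue. cmod (F x))" by simp
    finally show ?thesis using that by (simp add: field_simps power_divide)
  qed
  have "(\<lambda>N. (2 * real N) ^ CARD('n) * q ^ N * (LINT x|lebesgue. cmod (F x))) \<longlonglongrightarrow> 0"
    using tendsto_mult_left_zero[OF poly_mult_geometric_tendsto_0[OF q(1,2)]] by simp
  then have "C \<le> 0"
  proof (rule tendsto_lowerbound)
    show "\<forall>\<^sub>F N in sequentially. C \<le> (2 * real N) ^ CARD('n) * q ^ N * (LINT x|lebesgue. cmod (F x))"
      using eventually_gt_at_top[of 0] by eventually_elim (rule main)
  qed simp
  then show False using \<open>C > 0\<close> by simp
qed

section \<open>Symmetric convex bodies\<close>

text \<open>If \<open>x + v\<close> and \<open>x - v\<close> lie in a symmetric convex set, so does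
  \<open>v\<close>, the midpoint of \<open>x + v\<close> and \<open>-(x - v)\<close>. Hence a ball around any interior point moves to the origin.\<close>

lemma symmetric_convex_body_contains_ball:
  assumes "symmetric_convex_body K"
  obtains r where "r > 0" "ball 0 r \<subseteq> K"
proof -
  have K: "convex K" "\<And>x. x \<in> K \<Longrightarrow> - x \<in> K" and "interior K \<noteq> {}"
    using assms by (auto simp: symmetric_convex_body_def)
  then obtain x r where r: "r > 0" "ball x r \<subseteq> K"
    by (meson all_not_in_conv mem_interior)
  have "v \<in> K" if v: "v \<in> ball 0 r" for v
  proof -
    have "x + v \<in> ball x r" "x - v \<in> ball x r" using v by (auto simp: dist_norm)
    then have "x + v \<in> K" "- (x - v) \<in> K" using r(2) K(2) by blast+
    then have "(1/2) *\<^sub>R (x + v) + (1/2) *\<^sub>R (- (x - v)) \<in> K"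
      using \<open>convex K\<close> by (intro convexD) auto
    moreover have "(1/2) *\<^sub>R (x + v) + (1/2) *\<^sub>R (- (x - v)) = v"
      by (simp add: vec_eq_iff field_simps)
    ultimately show "v \<in> K" by simp
  qed
  then show ?thesis using that r(1) by blast
qed

text \<open>Dilations absorb small perturbations, so that passing from lattice
  points in \<open>K\<close> to the cubes attached to them costs only a factor close to 1 in volume.\<close>

lemma convex_add_small_ball_subset_dilation:
  fixes K :: "'a :: real_normed_vector set"
  assumes "convex K" "ball 0 r \<subseteq> K" "e > 0" "x \<in> K" "norm v < e * r"
  shows "x + v \<in> (*\<^sub>R) (1 + e) ` K"
proof -
  have "v /\<^sub>R e \<in> K"
    using assms by (intro subsetD[OF assms(2)]) (simp add: field_simps)
  then have "(1 / (1 + e)) *\<^sub>R x + (e / (1 + e)) *\<^sub>R (v /\<^sub>R e) \<in> K"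
    using assms by (intro convexD) (auto simp: add_divide_distrib[symmetric])
  moreover have "x + v = (1 + e) *\<^sub>R ((1 / (1 + e)) *\<^sub>R x + (e / (1 + e)) *\<^sub>R (v /\<^sub>R e))"
    using assms by (simp add: scaleR_add_right)
  ultimately show ?thesis by (rule rev_image_eqI)
qed

lemma symmetric_convex_body_zero:
  assumes "symmetric_convex_body K"
  shows "0 \<in> K"
  using symmetric_convex_body_contains_ball[OF assms] by (metis centre_in_ball subsetD)

lemma symmetric_convex_body_measure_pos:
  assumes "symmetric_convex_body K"
  shows "measure lebesgue K > 0"
proof -
  obtain r where r: "r > 0" "ball 0 r \<subseteq> K"
    using symmetric_convex_body_contains_ball[OF assms] .
  have "K \<in> lmeasurable" using assms by (auto simp: symmetric_convex_body_def lmeasurable_compact)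
  then have "measure lebesgue (ball 0 r :: (real ^ 'a) set) \<le> measure lebesgue K"
    using r by (intro measure_mono_fmeasurable) auto
  moreover have "measure lebesgue (ball 0 r :: (real ^ 'a) set) > 0"
    using r(1) by (simp add: content_ball_pos)
  ultimately show ?thesis by linarith
qed

section \<open>Lattices defined by congruences modulo a prime\<close>

text \<open>The rows of this matrix are a basis of the lattice of all
  \<open>\<epsilon> x\<close> with \<open>x \<in> \<int>\<^sup>n\<close> and \<open>x\<^sub>j \<equiv> x\<^sub>k a\<^sub>j (mod p)\<close> for \<open>j \<noteq> k\<close>. It is a sublattice of
  \<open>\<epsilon> \<int>\<^sup>n\<close> of index \<open>p^(n-1)\<close>, so that its covolume is \<open>\<epsilon>^n p^(n-1)\<close>.\<close>

definition basis_matrix :: "'n \<Rightarrow> real \<Rightarrow> nat \<Rightarrow> int ^ 'n \<Rightarrow> real ^ 'n ^ 'n" where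
  "basis_matrix k \<epsilon> p a = (\<chi> i j.
     if i = k then (if j = k then \<epsilon> else \<epsilon> * real_of_int (a $ j))
     else (if j = i then \<epsilon> * real p else 0))"

definition lattice_coords :: "'n \<Rightarrow> nat \<Rightarrow> int ^ 'n \<Rightarrow> int ^ 'n \<Rightarrow> int ^ 'n" where
  "lattice_coords k p a z = (\<chi> j. if j = k then z $ k else z $ k * a $ j + int p * z $ j)"

lemma int_point_mult_basis_matrix:
  "int_point z v* basis_matrix k \<epsilon> p a = \<epsilon> *\<^sub>R int_point (lattice_coords k p a z)"
proof -
  have "(\<Sum>i\<in>UNIV. basis_matrix k \<epsilon> p a $ i $ j * real_of_int (z $ i))
      = \<epsilon> * real_of_int (lattice_coords k p a z $ j)" for j
  proof -
    have "(\<Sum>i\<in>UNIV. basis_matrix k \<epsilon> p a $ i $ j * real_of_int (z $ i))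
        = basis_matrix k \<epsilon> p a $ k $ j * real_of_int (z $ k)
          + (\<Sum>i\<in>UNIV - {k}. basis_matrix k \<epsilon> p a $ i $ j * real_of_int (z $ i))"
      by (rule sum.remove) auto
    also have "(\<Sum>i\<in>UNIV - {k}. basis_matrix k \<epsilon> p a $ i $ j * real_of_int (z $ i))
        = (\<Sum>i\<in>UNIV - {k}. if j = i then \<epsilon> * real p * real_of_int (z $ i) else 0)"
      by (rule sum.cong) (auto simp: basis_matrix_def)
    also have "\<dots> = (if j \<noteq> k then \<epsilon> * real p * real_of_int (z $ j) else 0)"
      by (subst sum.delta') auto
    finally show ?thesis
      by (simp add: basis_matrix_def lattice_coords_def algebra_simps)
  qed
  then show ?thesis by (simp add: vec_eq_iff vector_matrix_mult_def mult.commute)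
qed

definition residue_vectors :: "'n \<Rightarrow> nat \<Rightarrow> (int ^ 'n) set" where
  "residue_vectors k p = {a. \<forall>j. a $ j \<in> (if j = k then {0} else {0..<int p})}"

lemma finite_residue_vectors: "finite (residue_vectors k p)"
  unfolding residue_vectors_def by (intro finite_box_vec) simp

lemma card_residue_vectors:
  fixes k :: "'n :: finite"
  shows "card (residue_vectors k p) = p ^ (CARD('n) - 1)"
proof -
  have "card (residue_vectors k p) = card (if k = k then {0::int} else {0..<int p})
      * (\<Prod>j\<in>UNIV - {k}. card (if j = k then {0} else {0..<int p}))"
    unfolding residue_vectors_def card_box_vec by (rule prod.remove) auto
  also have "(\<Prod>j\<in>UNIV - {k}. card (if j = k then {0} else {0..<int p})) = (\<Prod>j\<in>UNIV - {k}. p)"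
    by (rule prod.cong) auto
  finally show ?thesis by simp
qed

lemma residue_vectors_nth:
  assumes "a \<in> residue_vectors k p" "p > 0"
  shows "a $ k = 0" "a $ j \<in> {0..<int p}"
proof -
  have *: "a $ i \<in> (if i = k then {0} else {0..<int p})" for i
    using assms(1) unfolding residue_vectors_def by blast
  show "a $ k = 0" "a $ j \<in> {0..<int p}"
    using *[of k] *[of j] assms(2) by (auto split: if_splits)
qed

lemma basis_matrix_mult_vec:
  "(basis_matrix k \<epsilon> p a *v x) $ j =
     (if j = k then \<epsilon> * (x $ k + (\<Sum>i\<in>UNIV - {k}. real_of_int (a $ i) * x $ i)) else \<epsilon> * real p * x $ j)"
proof (cases "j = k")
  case True
  have "(\<Sum>i\<in>UNIV. basis_matrix k \<epsilon> p a $ k $ i * x $ i)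
      = \<epsilon> * x $ k + (\<Sum>i\<in>UNIV - {k}. basis_matrix k \<epsilon> p a $ k $ i * x $ i)"
    by (subst sum.remove[of _ k]) (auto simp: basis_matrix_def)
  also have "(\<Sum>i\<in>UNIV - {k}. basis_matrix k \<epsilon> p a $ k $ i * x $ i)
      = \<epsilon> * (\<Sum>i\<in>UNIV - {k}. real_of_int (a $ i) * x $ i)"
    unfolding sum_distrib_left by (rule sum.cong) (auto simp: basis_matrix_def)
  finally show ?thesis using True by (simp add: matrix_vector_mult_def distrib_left)
next
  case False
  have "(\<Sum>i\<in>UNIV. basis_matrix k \<epsilon> p a $ j $ i * x $ i)
      = (\<Sum>i\<in>UNIV. if i = j then \<epsilon> * real p * x $ i else 0)"
    using False by (intro sum.cong) (auto simp: basis_matrix_def)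
  then show ?thesis using False by (simp add: matrix_vector_mult_def)
qed

text \<open>The dual lattice of the lattice spanned by the rows is a union of
  \<open>p^(n-1)\<close> cosets \<open>\<gamma> c + (2\<pi>/\<epsilon>) \<int>\<^sup>n\<close>. So the union \<open>T\<close> of the corresponding \<open>p^(n-1)\<close> translates
  of \<open>S\<close> covers the space under the cubic lattice \<open>(2\<pi>/\<epsilon>) \<int>\<^sup>n\<close> alone, and the volume
  bound for cubic lattices applies to \<open>T\<close>. This computes the covolume by an index instead of a determinant.\<close>

lemma measure_ge_if_basis_matrix_image_cover:
  fixes S :: "(real ^ 'n) set"
  assumes "compact S" "\<epsilon> > 0" "p > 0"
    and cover: "\<And>y. \<exists>z. y + (2 * pi) *\<^sub>R int_point z \<in> (*v) (basis_matrix k \<epsilon> p a) ` S"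
  shows "(2 * pi) ^ CARD('n) \<le> \<epsilon> ^ CARD('n) * real p ^ (CARD('n) - 1) * measure lebesgue S"
proof -
  let ?M = "basis_matrix k \<epsilon> p a" and ?C = "residue_vectors k p"
  define \<gamma> :: "int ^ 'n \<Rightarrow> real ^ 'n" where
    "\<gamma> c = (\<chi> j. if j = k then - (\<Sum>i\<in>UNIV - {k}. real_of_int (a $ i) * (2 * pi * c $ i / (\<epsilon> * p)))
              else 2 * pi * c $ j / (\<epsilon> * p))" for c
  define T where "T = (\<Union>c\<in>?C. (+) (- \<gamma> c) ` S)"
  have "compact T"
    unfolding T_def by (intro compact_UN finite_residue_vectors compact_translation assms)
  have "\<exists>w. x + (2 * pi / \<epsilon>) *\<^sub>R int_point w \<in> T" for x
  proof -
    obtain z s where s: "s \<in> S" and eq: "?M *v x + (2 * pi) *\<^sub>R int_point z = ?M *v s"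
      using cover[of "?M *v x"] by auto
    \<comment> \<open>Division by \<open>p\<close> splits the dual vector that belongs to \<open>z\<close> into a coset
        representative, given by the remainders \<open>c\<close>, and an element \<open>w\<close> of the cubic lattice.\<close>
    define c where "c = (\<chi> j. if j = k then 0 else z $ j mod int p)"
    define q where "q j = z $ j div int p" for j
    define w where "w = (\<chi> j. if j = k then z $ k - (\<Sum>i\<in>UNIV - {k}. a $ i * q i) else q j)"
    have "c \<in> ?C" using \<open>p > 0\<close> by (simp add: c_def residue_vectors_def)
    have off: "s $ j - x $ j = 2 * pi * q j / \<epsilon> + 2 * pi * c $ j / (\<epsilon> * p)" if "j \<noteq> k" for j
    proof -
      have "\<epsilon> * real p * x $ j + 2 * pi * z $ j = \<epsilon> * real p * s $ j"
        using arg_cong[OF eq, of "\<lambda>v. v $ j"] that by (simp add: basis_matrix_mult_vec)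
      moreover have "z $ j = int p * q j + c $ j"
        using that by (simp add: q_def c_def)
      then have "real_of_int (z $ j) = real p * q j + c $ j" by simp
      ultimately show ?thesis using assms(2,3) by (simp add: field_simps)
    qed
    have "\<epsilon> * (x $ k + (\<Sum>i\<in>UNIV - {k}. real_of_int (a $ i) * x $ i)) + 2 * pi * z $ k
        = \<epsilon> * (s $ k + (\<Sum>i\<in>UNIV - {k}. real_of_int (a $ i) * s $ i))"
      using arg_cong[OF eq, of "\<lambda>v. v $ k"] by (simp add: basis_matrix_mult_vec)
    then have "\<epsilon> * (s $ k - x $ k) = 2 * pi * z $ k
        - \<epsilon> * ((\<Sum>i\<in>UNIV - {k}. real_of_int (a $ i) * s $ i) - (\<Sum>i\<in>UNIV - {k}. real_of_int (a $ i) * x $ i))"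
      by (simp add: algebra_simps)
    then have "s $ k - x $ k = 2 * pi * z $ k / \<epsilon>
        - ((\<Sum>i\<in>UNIV - {k}. real_of_int (a $ i) * s $ i) - (\<Sum>i\<in>UNIV - {k}. real_of_int (a $ i) * x $ i))"
      using assms(2) by (simp add: field_simps)
    also have "(\<Sum>i\<in>UNIV - {k}. real_of_int (a $ i) * s $ i) - (\<Sum>i\<in>UNIV - {k}. real_of_int (a $ i) * x $ i)
        = (\<Sum>i\<in>UNIV - {k}. real_of_int (a $ i) * (s $ i - x $ i))"
      by (simp add: sum_subtractf right_diff_distrib)
    also have "\<dots> = (\<Sum>i\<in>UNIV - {k}. 2 * pi / \<epsilon> * real_of_int (a $ i * q i)
        + real_of_int (a $ i) * (2 * pi * c $ i / (\<epsilon> * p)))"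
      by (rule sum.cong) (simp_all add: off algebra_simps)
    also have "\<dots> = 2 * pi / \<epsilon> * real_of_int (\<Sum>i\<in>UNIV - {k}. a $ i * q i) - \<gamma> c $ k"
      by (simp add: sum.distrib sum_distrib_left \<gamma>_def)
    finally have offk: "s $ k - x $ k = 2 * pi / \<epsilon> * w $ k + \<gamma> c $ k"
      by (simp add: w_def algebra_simps diff_divide_distrib)
    have "x $ j + 2 * pi / \<epsilon> * w $ j = - \<gamma> c $ j + s $ j" for j
    proof (cases "j = k")
      case True
      then show ?thesis using offk by simp
    next
      case False
      then show ?thesis using off[OF False] by (simp add: w_def \<gamma>_def)
    qed
    then have "x + (2 * pi / \<epsilon>) *\<^sub>R int_point w = - \<gamma> c + s"
      by (simp add: vec_eq_iff)
    then have "x + (2 * pi / \<epsilon>) *\<^sub>R int_point w \<in> T"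
      unfolding T_def using s \<open>c \<in> ?C\<close> by blast
    then show ?thesis ..
  qed
  then have "(2 * pi / \<epsilon>) ^ CARD('n) \<le> measure lebesgue T"
    using \<open>compact T\<close> assms(2) by (intro measure_ge_if_translates_cover) auto
  also have "\<dots> \<le> (\<Sum>c\<in>?C. measure lebesgue ((+) (- \<gamma> c) ` S))"
    unfolding T_def
    by (intro measure_UNION_le finite_residue_vectors fmeasurableD measurable_translation
        lmeasurable_compact assms)
  also have "\<dots> = real p ^ (CARD('n) - 1) * measure lebesgue S"
    by (simp only: measure_translation sum_constant card_residue_vectors of_nat_power)
  finally show ?thesis using assms(2) by (simp add: power_divide field_simps)
qed

lemma lattice_coords_uminus: "lattice_coords k p a (- z) = - lattice_coords k p a z"
  by (auto simp: lattice_coords_def vec_eq_iff)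

lemma lattice_coords_eq_0_iff: "p > 0 \<Longrightarrow> lattice_coords k p a z = 0 \<longleftrightarrow> z = 0"
proof (safe, goal_cases)
  case 1
  then have *: "lattice_coords k p a z $ j = 0" for j by simp
  have "z $ k = 0" using *[of k] by (simp add: lattice_coords_def)
  then have "z $ j = 0" for j 
    using *[of j] \<open>p > 0\<close> by (cases "j = k") (auto simp: lattice_coords_def)
  then show ?case by (simp add: vec_eq_iff)
qed (simp add: lattice_coords_def vec_eq_iff)

text \<open>The reason why \<open>p\<close> is prime: a lattice point whose \<open>k\<close>-th coordinate is
  invertible modulo \<open>p\<close> determines the slope vector \<open>a\<close>, and therefore the lattice.\<close>

lemma lattice_coords_determine_slope:
  assumes "prime p" "lattice_coords k p a z = lattice_coords k p b w"
    and "\<not> int p dvd z $ k" "a $ k = b $ k"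
    and a: "\<And>j. a $ j \<in> {0..<int p}" and b: "\<And>j. b $ j \<in> {0..<int p}"
  shows "a = b"
proof -
  have "a $ j = b $ j" for j
  proof (cases "j = k")
    case False
    have "lattice_coords k p a z $ i = lattice_coords k p b w $ i" for i
      using assms(2) by simp
    from this[of k] this[of j]
    have "z $ k = w $ k" "z $ k * a $ j + int p * z $ j = w $ k * b $ j + int p * w $ j"
      using False by (simp_all add: lattice_coords_def)
    then have "z $ k * (a $ j - b $ j) = int p * (w $ j - z $ j)"
      by (simp add: algebra_simps)
    then have "int p dvd z $ k * (a $ j - b $ j)" by simp
    then have "int p dvd a $ j - b $ j"
      using assms(1,3) prime_dvd_mult_iff[of "int p"] by simp
    moreover have "\<bar>a $ j - b $ j\<bar> < int p" using a[of j] b[of j] by auto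
    ultimately show ?thesis using zdvd_imp_le[of "int p" "\<bar>a $ j - b $ j\<bar>"] by force
  qed (use assms in simp)
  then show ?thesis by (simp add: vec_eq_iff)
qed

text \<open>If the \<open>k\<close>-th coordinate is divisible by \<open>p\<close>, the congruences make all
  coordinates divisible by \<open>p\<close>.\<close>

lemma lattice_coords_large:
  assumes "z \<noteq> 0" "p > 0" "int p dvd z $ k"
  obtains j where "\<bar>lattice_coords k p a z $ j\<bar> \<ge> int p"
proof -
  have "lattice_coords k p a z \<noteq> 0" using assms lattice_coords_eq_0_iff by blast
  then obtain j where j: "lattice_coords k p a z $ j \<noteq> 0" by (auto simp: vec_eq_iff)
  have "int p dvd lattice_coords k p a z $ j"
    using assms(3) by (auto simp: lattice_coords_def)
  then have "\<bar>lattice_coords k p a z $ j\<bar> \<ge> int p"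
    using j zdvd_imp_le[of "int p" "\<bar>lattice_coords k p a z $ j\<bar>"] by simp
  then show ?thesis using that by blast
qed

section \<open>A lattice of small covolume that avoids a convex body\<close>

text \<open>Suppose that each of the \<open>p^(n-1)\<close> lattices has a nonzero point in \<open>K\<close>.
  Since \<open>\<epsilon> p\<close> exceeds the norms of all points of \<open>K\<close>, the \<open>k\<close>-th integer coordinates of these
  points are not divisible by \<open>p\<close>.
  So the points are distinct up to sign, and \<open>K\<close> contains at least \<open>2 p^(n-1)\<close> points
  of \<open>\<epsilon> \<int>\<^sup>n\<close>. The cubes attached to them lie in \<open>(1 + e) K\<close>, so that
  \<open>2 p^(n-1) \<epsilon>^n \<le> (1 + e)^n |K|\<close>. The left side is \<open>2 d\<close>, a contradiction for small \<open>e\<close>. Here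
  the side \<open>\<epsilon>\<close> of the cubes has to tend to 0 as \<open>p\<close> grows while the covolume \<open>d\<close> stays fixed, and
  this happens in dimension at least two.\<close>

lemma lattice_avoiding_convex_body:
  fixes K :: "(real ^ 'n) set" and k :: 'n
  assumes "CARD('n) > 1" "symmetric_convex_body K" "measure lebesgue K < 2 * d"
  obtains \<epsilon> p a where "\<epsilon> > 0" "p > 0" "\<epsilon> ^ CARD('n) * real p ^ (CARD('n) - 1) = d"
    "\<And>z. z \<noteq> 0 \<Longrightarrow> int_point z v* basis_matrix k \<epsilon> p a \<notin> K"
proof -
  define n where "n = CARD('n)"
  define V where "V = measure lebesgue K"
  have n: "n > 1" using assms by (simp add: n_def)
  have K: "compact K" "convex K" and sym: "\<And>x. x \<in> K \<Longrightarrow> - x \<in> K"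
    using assms by (auto simp: symmetric_convex_body_def)
  have "V > 0" unfolding V_def using assms(2) by (rule symmetric_convex_body_measure_pos)
  then have "d > 0" using assms(3) by (simp add: V_def)
  obtain r where r: "r > 0" "ball 0 r \<subseteq> K"
    using symmetric_convex_body_contains_ball[OF assms(2)] .
  obtain R where R: "R > 0" "\<And>x. x \<in> K \<Longrightarrow> norm x \<le> R"
    using compact_imp_bounded[OF K(1)] by (auto simp: bounded_pos)
  obtain e where e: "e > 0" "(1 + e) ^ n * V < 2 * d"
  proof -
    have "root n (2 * d / V) > 1" using n \<open>V > 0\<close> assms(3) by (simp add: V_def)
    then obtain c where c: "1 < c" "c < root n (2 * d / V)" using dense by blast
    then have "c ^ n < root n (2 * d / V) ^ n" using n by (intro power_strict_mono) auto
    also have "\<dots> = 2 * d / V" using n \<open>V > 0\<close> \<open>d > 0\<close> by simp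
    finally show ?thesis using that[of "c - 1"] c \<open>V > 0\<close> by (simp add: field_simps)
  qed
  \<comment> \<open>The first bound on \<open>p\<close> gives \<open>\<epsilon> p > R\<close>, the second makes the cubes of side \<open>\<epsilon>\<close>
      small enough for \<open>(1 + e) K\<close> to absorb them.\<close>
  define B where "B = max (R ^ n / d) (d * (real n / (e * r)) ^ n)"
  obtain p where p: "prime p" "real p > B"
    using bigger_prime[of "nat \<lceil>B\<rceil>"] by (metis le_less_trans nat_ceiling_le_eq of_nat_less_iff order_refl real_nat_ceiling_ge)
  have "p > 0" using p(1) by (rule prime_gt_0_nat)
  define \<epsilon> where "\<epsilon> = root n (d / real p ^ (n - 1))"
  have \<epsilon>: "\<epsilon> > 0" "\<epsilon> ^ n * real p ^ (n - 1) = d"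
    using n \<open>d > 0\<close> \<open>p > 0\<close> by (auto simp: \<epsilon>_def)
  have large: "\<epsilon> * real p > R"
  proof (rule power_less_imp_less_base)
    have "R ^ n < d * real p" using p(2) \<open>d > 0\<close> by (simp add: B_def field_simps)
    also have "\<dots> = (\<epsilon> * real p) ^ n"
      using n by (simp add: \<epsilon>(2)[symmetric] power_mult_distrib power_eq_if[of _ n] mult.assoc mult.commute)
    finally show "R ^ n < (\<epsilon> * real p) ^ n" .
  qed (use \<epsilon> in simp)
  have small: "real n * \<epsilon> < e * r"
  proof -
    have "\<epsilon> ^ n * real p \<le> \<epsilon> ^ n * real p ^ (n - 1)"
      using n \<epsilon>(1) \<open>p > 0\<close> self_le_power[of "real p" "n - 1"] by (intro mult_left_mono) auto
    then have "\<epsilon> ^ n * real p \<le> d" using \<epsilon>(2) by simp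
    moreover have "d * (real n / (e * r)) ^ n < real p" using p(2) by (simp add: B_def)
    ultimately have "d * (real n / (e * r)) ^ n * \<epsilon> ^ n < d"
      by (smt (verit) \<epsilon>(1) mult.commute mult_strict_left_mono zero_less_power)
    then have "d * (real n * \<epsilon> / (e * r)) ^ n < d * 1"
      by (simp add: power_mult_distrib power_divide mult_ac)
    then have "(real n * \<epsilon> / (e * r)) ^ n < 1 ^ n"
      using \<open>d > 0\<close> by simp
    then have "real n * \<epsilon> / (e * r) < 1" by (rule power_less_imp_less_base) simp
    then show ?thesis using e r by (simp add: field_simps)
  qed
  define A where "A = residue_vectors k p"
  have "finite A" and cardA: "card A = p ^ (n - 1)"
    by (simp_all add: A_def finite_residue_vectors card_residue_vectors n_def)
  have A: "a $ k = 0" "a $ j \<in> {0..<int p}" if "a \<in> A" for a j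
    using residue_vectors_nth[OF that[unfolded A_def] \<open>p > 0\<close>] by auto
  have "\<exists>a\<in>A. \<forall>z. z \<noteq> 0 \<longrightarrow> int_point z v* basis_matrix k \<epsilon> p a \<notin> K"
  proof (rule ccontr)
    assume "\<not> ?thesis"
    then have bad: "\<exists>z. z \<noteq> 0 \<and> \<epsilon> *\<^sub>R int_point (lattice_coords k p a z) \<in> K" if "a \<in> A" for a
      using that by (metis int_point_mult_basis_matrix)
    have "\<exists>z. z $ k > 0 \<and> \<not> int p dvd z $ k \<and> \<epsilon> *\<^sub>R int_point (lattice_coords k p a z) \<in> K"
      if a: "a \<in> A" for a
    proof -
      obtain z where z: "z \<noteq> 0" "\<epsilon> *\<^sub>R int_point (lattice_coords k p a z) \<in> K" using bad[OF a] by blast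
      have ndvd: "\<not> int p dvd z $ k"
      proof
        assume "int p dvd z $ k"
        then obtain j where j: "\<bar>lattice_coords k p a z $ j\<bar> \<ge> int p"
          using lattice_coords_large[OF z(1) \<open>p > 0\<close>] by metis
        then have "real p \<le> \<bar>real_of_int (lattice_coords k p a z $ j)\<bar>" by linarith
        then have "\<epsilon> * real p \<le> \<bar>(\<epsilon> *\<^sub>R int_point (lattice_coords k p a z)) $ j\<bar>"
          using \<epsilon>(1) by (simp add: abs_mult)
        also have "\<dots> \<le> R" by (rule order_trans[OF component_le_norm_cart R(2)[OF z(2)]])
        finally show False using large by simp
      qed
      then have "z $ k > 0 \<or> (- z) $ k > 0" by (cases "z $ k = 0") auto
      moreover have "\<epsilon> *\<^sub>R int_point (lattice_coords k p a (- z)) \<in> K"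
        using sym[OF z(2)] by (simp add: lattice_coords_uminus int_point_uminus)
      moreover have "\<not> int p dvd (- z) $ k" using ndvd by simp
      ultimately show ?thesis using z ndvd by blast
    qed
    then obtain Z where Z: "\<And>a. a \<in> A \<Longrightarrow> Z a $ k > 0" "\<And>a. a \<in> A \<Longrightarrow> \<not> int p dvd Z a $ k"
      "\<And>a. a \<in> A \<Longrightarrow> \<epsilon> *\<^sub>R int_point (lattice_coords k p a (Z a)) \<in> K"
      by metis
    \<comment> \<open>The sign of \<open>z\<close> was chosen with positive \<open>k\<close>-th coordinate, to keep the points
        and their negatives apart.\<close>
    define f where "f a = lattice_coords k p a (Z a)" for a
    have fk: "f a $ k > 0" if "a \<in> A" for a using Z(1)[OF that] by (simp add: f_def lattice_coords_def)
    have "inj_on f A"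
    proof (rule inj_onI)
      fix a b assume ab: "a \<in> A" "b \<in> A" "f a = f b"
      show "a = b"
        by (rule lattice_coords_determine_slope[OF p(1) ab(3)[unfolded f_def] Z(2)[OF ab(1)]])
          (use A ab in auto)
    qed
    then have "card (f ` A) = p ^ (n - 1)" using cardA by (simp add: card_image)
    moreover have "card (uminus ` f ` A) = card (f ` A)" by (rule card_image) simp
    moreover have "f ` A \<inter> uminus ` f ` A = {}"
    proof -
      have "f a \<noteq> - f b" if "a \<in> A" "b \<in> A" for a b
        using fk[OF that(1)] fk[OF that(2)] by (metis less_asym neg_less_0_iff_less vector_uminus_component)
      then show ?thesis by blast
    qed
    ultimately have card2: "card (f ` A \<union> uminus ` f ` A) = 2 * p ^ (n - 1)"
      using \<open>finite A\<close> by (subst card_Un_disjoint) simp_all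
    have "real (card (f ` A \<union> uminus ` f ` A)) * \<epsilon> ^ CARD('n) \<le> measure lebesgue ((*\<^sub>R) (1 + e) ` K)"
    proof (rule card_cubes_le_measure)
      show "(*\<^sub>R) (1 + e) ` K \<in> lmeasurable" using K(1) by (intro lmeasurable_compact compact_scaling)
      fix x assume "x \<in> f ` A \<union> uminus ` f ` A"
      then have x: "\<epsilon> *\<^sub>R int_point x \<in> K"
        using Z(3) sym by (fastforce simp: f_def int_point_uminus)
      show "(+) (\<epsilon> *\<^sub>R int_point x) ` half_open_cube \<epsilon> \<subseteq> (*\<^sub>R) (1 + e) ` K"
      proof safe
        fix v :: "real ^ 'n" assume v: "v \<in> half_open_cube \<epsilon>"
        have "norm v \<le> (\<Sum>j\<in>UNIV. \<bar>v $ j\<bar>)" by (rule norm_le_l1_cart)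
        also have "\<dots> \<le> (\<Sum>j\<in>(UNIV::'n set). \<epsilon>)"
        proof (rule sum_mono)
          fix j
          have "0 \<le> v $ j" "v $ j < \<epsilon>" using v by (auto simp: half_open_cube_def)
          then show "\<bar>v $ j\<bar> \<le> \<epsilon>" by simp
        qed
        also have "\<dots> < e * r" using small by (simp add: n_def)
        finally show "\<epsilon> *\<^sub>R int_point x + v \<in> (*\<^sub>R) (1 + e) ` K"
          by (rule convex_add_small_ball_subset_dilation[OF K(2) r(2) e(1) x])
      qed
    qed (use \<epsilon>(1) \<open>finite A\<close> in auto)
    also have "\<dots> = (1 + e) ^ n * V"
      using measure_lebesgue_affine[of "1 + e" 0 K] e(1) by (simp add: n_def V_def)
    finally have "2 * d \<le> (1 + e) ^ n * V"
      unfolding card2 using \<epsilon>(2) by (simp add: n_def mult_ac)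
    then show False using e(2) by simp
  qed
  then obtain a where a: "\<And>z. z \<noteq> 0 \<Longrightarrow> int_point z v* basis_matrix k \<epsilon> p a \<notin> K" by blast
  show ?thesis
    by (rule that[OF \<epsilon>(1) \<open>p > 0\<close> \<epsilon>(2)[unfolded n_def] a])
qed

section \<open>The volume inequality\<close>

theorem theorem5p1:
  fixes S K :: "(real ^ 'n) set"
  assumes "CARD('n) > 1"
    and "symmetric_convex_body S"
    and "symmetric_convex_body K"
    and "\<And>L :: (real ^ 'n) set. difference_set L \<inter> K = {0} \<Longrightarrow> interpolation_set S L"
  shows "measure lebesgue S * measure lebesgue K > (2 * pi) ^ CARD('n)"
proof -
  define V where "V = measure lebesgue K"
  have "V > 0" unfolding V_def using assms(3) by (rule symmetric_convex_body_measure_pos)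
  have "0 \<in> K" using assms(3) by (rule symmetric_convex_body_zero)
  obtain k :: 'n where True by blast
  \<comment> \<open>Any covolume strictly between \<open>V / 2\<close> and \<open>V\<close> would do.\<close>
  obtain \<epsilon> p a where lattice: "\<epsilon> > 0" "p > 0" "\<epsilon> ^ CARD('n) * real p ^ (CARD('n) - 1) = 3 / 4 * V"
    "\<And>z. z \<noteq> 0 \<Longrightarrow> int_point z v* basis_matrix k \<epsilon> p a \<notin> K"
    by (rule lattice_avoiding_convex_body[OF assms(1,3), of "3 / 4 * V"]) (use \<open>V > 0\<close> in \<open>auto simp: V_def\<close>)
  let ?M = "basis_matrix k \<epsilon> p a"
  let ?L = "range (\<lambda>z. int_point z v* ?M)"
  have zero: "int_point 0 v* ?M = 0"
    by (simp add: vec_eq_iff vector_matrix_mult_def)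
  have "difference_set ?L = ?L"
  proof -
    have "int_point z v* ?M - int_point w v* ?M = int_point (z - w) v* ?M" for z w
      by (simp add: int_point_diff vector_matrix_mult_diff_distrib)
    moreover have "int_point z v* ?M = int_point z v* ?M - int_point 0 v* ?M" for z
      by (simp add: zero)
    ultimately show ?thesis unfolding difference_set_def by blast
  qed
  moreover have "?L \<inter> K = {0}" using lattice(4) \<open>0 \<in> K\<close> zero by (auto intro: rangeI[of _ 0] rev_image_eqI) metis
  ultimately have interp: "interpolation_set S ?L" using assms(4) by simp
  have S: "compact S" using assms(2) by (simp add: symmetric_convex_body_def)
  have nz: "int_point z v* ?M \<noteq> 0" if "z \<noteq> 0" for z
    using lattice(4)[OF that] \<open>0 \<in> K\<close> by auto
  have *: "(2 * pi) ^ CARD('n) \<le> 3 / 4 * V * measure lebesgue S"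
    unfolding lattice(3)[symmetric]
    by (rule measure_ge_if_basis_matrix_image_cover[OF S lattice(1,2)])
      (rule interpolation_lattice_imp_cover[OF S nz interp])
  have "measure lebesgue S > 0" using assms(2) by (rule symmetric_convex_body_measure_pos)
  with \<open>V > 0\<close> have "3 / 4 * V * measure lebesgue S < V * measure lebesgue S" by simp
  from le_less_trans[OF * this] show ?thesis unfolding V_def by (simp only: mult.commute)
qed

end
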